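(* Suppose $f:\{0,1\}^n\to\{0,1\}$ with $f^{-1}(1)\neq\emptyset$ satisfies $\mathrm{rel}\text{-}\mathrm{dist}(f,f')>\varepsilon$ for every anti-monotone conjunction $f'$. Then, provided the absolute constants $c_1,c_2$ are sufficiently large, the following algorithm rejects $f$ with probability at least $0.9$. Phase 1: repeat $c_1/\varepsilon$ times: draw $x,y\sim\mathrm{Samp}(f)$; if $f(x\oplus y)=0$, halt and reject. Phase 2: repeat $c_2$ times: draw $x\sim\mathrm{Samp}(f)$, draw $y$ uniformly from $\{y:y\preceq x\}$, draw $u\sim\mathrm{Samp}(f)$; if $f(y\oplus u)=0$, halt and reject. Finally, accept.
   Context: An anti-monotone conjunction is a conjunction of negated variables. $\mathrm{rel}\text{-}\mathrm{dist}(f,g)=|f^{-1}(1)\triangle g^{-1}(1)|/|f^{-1}(1)|$. $\mathrm{Samp}(f)$ returns an independent uniformly random element of $f^{-1}(1)$; values of $f$ are obtained by membership queries. $\oplus$ is coordinatewise XOR; $y\preceq x$ means $y_i\le x_i$ for all $i$. *)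

theory Defs
  imports "HOL-Probability.Probability"
begin

(* The dimension n has to be quantified inside the statement, below the absolute
   constants, so it cannot be an index type.  A point of {0,1}^n is a function
   nat => bool that is False outside the coordinates 0, ..., n - 1; the order "y below x"
   is then the library's pointwise order y \<le> x on nat => bool.  A Boolean function on
   {0,1}^n is a predicate on such points; its values outside cube n are never used. *)

definition cube :: "nat \<Rightarrow> (nat \<Rightarrow> bool) set" where
  "cube n = {x. \<forall>i\<ge>n. \<not> x i}"

definition xor_pt :: "(nat \<Rightarrow> bool) \<Rightarrow> (nat \<Rightarrow> bool) \<Rightarrow> (nat \<Rightarrow> bool)" (infixl "\<oplus>" 65) where
  "x \<oplus> y = (\<lambda>i. x i \<noteq> y i)"

definition ones :: "nat \<Rightarrow> ((nat \<Rightarrow> bool) \<Rightarrow> bool) \<Rightarrow> (nat \<Rightarrow> bool) set" where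
  "ones n f = {x \<in> cube n. f x}"

(* The empty conjunction (S = {}), i.e. the constant-1 function, is allowed: the tester
   never rejects that function. *)
definition anti_monotone_conjunction :: "nat \<Rightarrow> ((nat \<Rightarrow> bool) \<Rightarrow> bool) \<Rightarrow> bool" where
  "anti_monotone_conjunction n g \<longleftrightarrow>
     (\<exists>S\<subseteq>{..<n}. \<forall>x\<in>cube n. g x \<longleftrightarrow> (\<forall>i\<in>S. \<not> x i))"

definition rel_dist ::
  "nat \<Rightarrow> ((nat \<Rightarrow> bool) \<Rightarrow> bool) \<Rightarrow> ((nat \<Rightarrow> bool) \<Rightarrow> bool) \<Rightarrow> real" where
  "rel_dist n f g = real (card (sym_diff (ones n f) (ones n g))) / real (card (ones n f))"

definition Samp :: "nat \<Rightarrow> ((nat \<Rightarrow> bool) \<Rightarrow> bool) \<Rightarrow> (nat \<Rightarrow> bool) pmf" where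
  "Samp n f = pmf_of_set (ones n f)"

lemma finite_cube: "finite (cube n)"
proof -
  have "cube n \<subseteq> (\<lambda>S i. i \<in> S) ` Pow {..<n}"
  proof
    fix x assume "x \<in> cube n"
    then have "x = (\<lambda>i. i \<in> {j. x j})" "{j. x j} \<subseteq> {..<n}"
      by (auto simp: cube_def) (meson not_le)
    then show "x \<in> (\<lambda>S i. i \<in> S) ` Pow {..<n}" by blast
  qed
  then show ?thesis by (rule finite_subset) simp
qed

lemma set_pmf_Samp: "ones n f \<noteq> {} \<Longrightarrow> set_pmf (Samp n f) = ones n f"
  by (simp add: Samp_def ones_def finite_cube)

datatype verdict = Accept | Reject

(* Run up to k independent copies of the test t (which returns True when it passes),
   halting with Reject at the first failure; if all of them pass, go on with next_step. *)
primrec repeat_test :: "nat \<Rightarrow> bool pmf \<Rightarrow> verdict pmf \<Rightarrow> verdict pmf" where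
  "repeat_test 0 t next_step = next_step"
| "repeat_test (Suc k) t next_step =
     do { ok \<leftarrow> t; if ok then repeat_test k t next_step else return_pmf Reject }"

definition phase1_test :: "nat \<Rightarrow> ((nat \<Rightarrow> bool) \<Rightarrow> bool) \<Rightarrow> bool pmf" where
  "phase1_test n f =
     do { x \<leftarrow> Samp n f; y \<leftarrow> Samp n f; return_pmf (f (x \<oplus> y)) }"

definition phase2_test :: "nat \<Rightarrow> ((nat \<Rightarrow> bool) \<Rightarrow> bool) \<Rightarrow> bool pmf" where
  "phase2_test n f =
     do { x \<leftarrow> Samp n f; y \<leftarrow> pmf_of_set {y \<in> cube n. y \<le> x}; u \<leftarrow> Samp n f;
          return_pmf (f (y \<oplus> u)) }"

(* The repetition count c1 / eps is rounded up to an integer. *)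
definition tester ::
  "real \<Rightarrow> nat \<Rightarrow> real \<Rightarrow> nat \<Rightarrow> ((nat \<Rightarrow> bool) \<Rightarrow> bool) \<Rightarrow> verdict pmf" where
  "tester c\<^sub>1 c\<^sub>2 \<epsilon> n f =
     repeat_test (nat \<lceil>c\<^sub>1 / \<epsilon>\<rceil>) (phase1_test n f)
       (repeat_test c\<^sub>2 (phase2_test n f) (return_pmf Accept))"

end

(* Let A be the set of satisfying points and put d(z) = |A - (A + z)|; d is subadditive, and
   phase 1 rejects in one round with probability (SUM z:A. d(z)) / |A|^2.  If this is below
   \<epsilon>/200, then H = {z. d(z) <= |A|/5} is a subgroup of the cube that differs from A in fewer than
   \<epsilon>|A| points: it is closed under \<oplus> because any z with d(z) <= 2|A|/5 is a sum of two points of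
   A with d <= |A|/10, so d(z) <= |A|/5 already.  A subgroup containing the unit vector e_i of every
   coordinate i on which it does not vanish is an anti-monotone conjunction, so H contains some h
   with h_i = 1 but not e_i.  Half of H, hence nearly half of A, has x_i = 1; for such x at most one
   of y and y \<oplus> e_i lies in H, and y outside H has y \<oplus> u outside A with probability over 1/5. *)
theory Submission
  imports Defs
begin

section \<open>Exclusive or on points\<close>

lemma xor_assoc: "(x \<oplus> y) \<oplus> z = x \<oplus> (y \<oplus> z)"
  by (auto simp: xor_pt_def fun_eq_iff)

lemma xor_commute: "x \<oplus> y = y \<oplus> x"
  by (auto simp: xor_pt_def fun_eq_iff)

lemma xor_self [simp]: "x \<oplus> x = (\<lambda>_. False)"
  by (auto simp: xor_pt_def fun_eq_iff)

lemma xor_zero [simp]: "x \<oplus> (\<lambda>_. False) = x"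
  by (auto simp: xor_pt_def fun_eq_iff)

lemma xor_cancel_left [simp]: "x \<oplus> (x \<oplus> y) = y"
  by (auto simp: xor_pt_def fun_eq_iff)

lemma xor_cancel_right [simp]: "(x \<oplus> y) \<oplus> y = x"
  by (auto simp: xor_pt_def fun_eq_iff)

lemma xor_cancel_outer [simp]: "x \<oplus> (y \<oplus> x) = y" "(x \<oplus> y) \<oplus> x = y"
  by (auto simp: xor_pt_def fun_eq_iff)

lemma inj_on_xor: "inj_on (\<lambda>x. x \<oplus> z) S"
  by (rule inj_on_inverseI [where g = "\<lambda>x. x \<oplus> z"]) simp

lemma xor_in_cube: "x \<in> cube n \<Longrightarrow> y \<in> cube n \<Longrightarrow> x \<oplus> y \<in> cube n"
  by (auto simp: cube_def xor_pt_def)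

section \<open>Nearly additively closed sets\<close>

text \<open>This is \<open>d\<close> of the overview: translation by \<open>z\<close> is an
  involution, so \<open>x \<oplus> z \<notin> A\<close> says that \<open>x\<close> is not in the
  translate A + z.\<close>

definition defect :: "(nat \<Rightarrow> bool) set \<Rightarrow> (nat \<Rightarrow> bool) \<Rightarrow> nat" where
  "defect A z = card {x \<in> A. x \<oplus> z \<notin> A}"

lemma defect_zero [simp]: "defect A (\<lambda>_. False) = 0"
proof -
  have "{x \<in> A. x \<notin> A} = {}" by blast
  then show ?thesis by (simp add: defect_def)
qed

lemma card_overlap_plus_defect:
  assumes "finite A"
  shows "card {x \<in> A. x \<oplus> z \<in> A} + defect A z = card A"
proof -
  have "card ({x \<in> A. x \<oplus> z \<in> A} \<union> {x \<in> A. x \<oplus> z \<notin> A})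
      = card {x \<in> A. x \<oplus> z \<in> A} + defect A z"
    unfolding defect_def using assms by (intro card_Un_disjoint) auto
  moreover have "{x \<in> A. x \<oplus> z \<in> A} \<union> {x \<in> A. x \<oplus> z \<notin> A} = A" by blast
  ultimately show ?thesis by simp
qed

text \<open>If \<open>x\<close> survives the shift by \<open>z\<close> but not the one by
  \<open>z \<oplus> w\<close>, then \<open>x \<oplus> z\<close> is a point of \<open>A\<close> that
  the shift by \<open>w\<close> expels. Translation by \<open>z\<close> is injective, so
  \<open>defect A w\<close> bounds the number of such \<open>x\<close>.\<close>

lemma defect_xor_le:
  assumes "finite A"
  shows "defect A (z \<oplus> w) \<le> defect A z + defect A w"
proof -
  let ?X = "{x \<in> A. x \<oplus> z \<in> A \<and> (x \<oplus> z) \<oplus> w \<notin> A}"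
  have "(\<lambda>x. x \<oplus> z) ` ?X \<subseteq> {x \<in> A. x \<oplus> w \<notin> A}" by auto
  then have X: "card ?X \<le> defect A w"
    unfolding defect_def using assms by (intro card_inj_on_le [OF inj_on_xor]) auto
  have "defect A (z \<oplus> w) \<le> card ({x \<in> A. x \<oplus> z \<notin> A} \<union> ?X)"
    unfolding defect_def using assms by (intro card_mono) (auto simp: xor_assoc)
  also have "\<dots> \<le> defect A z + card ?X"
    unfolding defect_def by (rule card_Un_le)
  finally show ?thesis using X by simp
qed

text \<open>An approximate stabilizer of \<open>A\<close> under translation, the H of the overview.
  The threshold 1/5 is low enough for closure under \<open>\<oplus>\<close>, yet every point outside
  has more than a 1/5 chance of being caught by a random \<open>u\<close>.\<close>

definition stabilizer :: "(nat \<Rightarrow> bool) set \<Rightarrow> (nat \<Rightarrow> bool) set" where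
  "stabilizer A = {z. 5 * defect A z \<le> card A}"

lemma stabilizer_zero [simp]: "(\<lambda>_. False) \<in> stabilizer A"
  by (simp add: stabilizer_def)

text \<open>A defect below \<open>card A\<close> leaves some \<open>x\<close> with \<open>x\<close>
  and \<open>x \<oplus> z\<close> both in \<open>A\<close>, and \<open>z\<close> is their sum. For
  empty \<open>A\<close> every point would qualify.\<close>

lemma stabilizer_subset_cube:
  assumes "A \<subseteq> cube n" "A \<noteq> {}"
  shows "stabilizer A \<subseteq> cube n"
proof
  fix z assume z: "z \<in> stabilizer A"
  have fin: "finite A" using assms(1) finite_cube finite_subset by blast
  then have "card A > 0" using assms(2) by (simp add: card_gt_0_iff)
  then have "card {x \<in> A. x \<oplus> z \<in> A} > 0"
    using z card_overlap_plus_defect [OF fin, of z] by (auto simp: stabilizer_def)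
  then obtain x where "x \<in> A" "x \<oplus> z \<in> A" by (auto simp: card_gt_0_iff)
  then have "x \<oplus> (x \<oplus> z) \<in> cube n" using assms(1) xor_in_cube by blast
  then show "z \<in> cube n" by simp
qed

lemma stabilizer_xor:
  assumes fin: "finite A" and "A \<noteq> {}"
    and sm: "100 * (\<Sum>x\<in>A. defect A x) \<le> card A * card A"
    and z: "z \<in> stabilizer A" and w: "w \<in> stabilizer A"
  shows "z \<oplus> w \<in> stabilizer A"
proof -
  define B where "B = {x \<in> A. 10 * defect A x > card A}"
  define v where "v = z \<oplus> w"
  have pos: "card A > 0" using assms by (simp add: card_gt_0_iff)
  have finB: "finite B" using fin by (simp add: B_def)
  \<comment> \<open>Markov's inequality: the average defect over \<open>A\<close> is at most
    \<open>card A\<close> / 100, so at most a tenth of \<open>A\<close> has defect above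
    \<open>card A\<close> / 10.\<close>
  have "card B * card A \<le> (\<Sum>x\<in>B. 10 * defect A x)"
    using sum_mono [of B "\<lambda>_. card A" "\<lambda>x. 10 * defect A x"] by (auto simp: B_def)
  also have "\<dots> \<le> (\<Sum>x\<in>A. 10 * defect A x)"
    using fin by (intro sum_mono2) (auto simp: B_def)
  finally have "10 * (card B * card A) \<le> card A * card A"
    using sm by (simp only: sum_distrib_left [symmetric])
  then have B: "10 * card B \<le> card A" using pos by simp
  have shift: "card {x. x \<oplus> v \<in> B} \<le> card B"
    using finB by (intro card_inj_on_le [OF inj_on_xor]) auto
  have v: "5 * defect A v \<le> 2 * card A"
    using defect_xor_le [OF fin, of z w] z w by (simp add: stabilizer_def v_def)
  \<comment> \<open>At least 3/5 of \<open>A\<close> stays in \<open>A\<close> under the shift by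
    \<open>v\<close>, while \<open>B\<close> and its translate together cover at most 1/5. What
    remains supplies two points of small defect whose sum is \<open>v\<close>.\<close>
  have "\<not> {x \<in> A. x \<oplus> v \<in> A} \<subseteq> B \<union> {x. x \<oplus> v \<in> B}"
  proof
    assume *: "{x \<in> A. x \<oplus> v \<in> A} \<subseteq> B \<union> {x. x \<oplus> v \<in> B}"
    \<comment> \<open>The preimage ranges over all of \<open>nat \<Rightarrow> bool\<close>, so its
      finiteness is taken from the translate of \<open>B\<close> that contains it.\<close>
    have "finite ((\<lambda>x. x \<oplus> v) ` B)" using finB by simp
    moreover have "{x. x \<oplus> v \<in> B} \<subseteq> (\<lambda>x. x \<oplus> v) ` B"
      by (metis (mono_tags, lifting) image_iff mem_Collect_eq subsetI xor_cancel_right)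
    ultimately have "finite {x. x \<oplus> v \<in> B}" by (rule rev_finite_subset)
    then have "card {x \<in> A. x \<oplus> v \<in> A} \<le> card (B \<union> {x. x \<oplus> v \<in> B})"
      using * finB by (intro card_mono) auto
    also have "\<dots> \<le> card B + card {x. x \<oplus> v \<in> B}" by (rule card_Un_le)
    finally show False
      using B v shift pos card_overlap_plus_defect [OF fin, of v] by linarith
  qed
  then obtain x where x: "x \<in> A" "x \<oplus> v \<in> A" "x \<notin> B" "x \<oplus> v \<notin> B" by blast
  have "defect A (x \<oplus> (x \<oplus> v)) \<le> defect A x + defect A (x \<oplus> v)"
    by (rule defect_xor_le [OF fin])
  then show ?thesis using x by (simp add: stabilizer_def B_def v_def)
qed

text \<open>Markov's inequality again: each point of \<open>A\<close> outside the stabilizer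
  contributes more than \<open>card A\<close> / 5 to the sum.\<close>

lemma card_minus_stabilizer:
  assumes fin: "finite A"
  shows "card A * card (A - stabilizer A) \<le> 5 * (\<Sum>x\<in>A. defect A x)"
proof -
  have "card A * card (A - stabilizer A) = (\<Sum>x\<in>A - stabilizer A. card A)" by simp
  also have "\<dots> \<le> (\<Sum>x\<in>A - stabilizer A. 5 * defect A x)"
    by (intro sum_mono) (auto simp: stabilizer_def)
  also have "\<dots> \<le> (\<Sum>x\<in>A. 5 * defect A x)"
    using fin by (intro sum_mono2) auto
  finally show ?thesis by (simp add: sum_distrib_left)
qed

text \<open>Double counting of the pairs \<open>(x, u)\<close> in \<open>A\<close> whose sum \<open>z\<close> lies outside \<open>A\<close>.\<close>

lemma card_stabilizer_minus:
  assumes A: "A \<subseteq> cube n" "A \<noteq> {}"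
  shows "4 * card A * card (stabilizer A - A) \<le> 5 * (\<Sum>x\<in>A. defect A x)"
proof -
  let ?H = "stabilizer A - A"
  have fin: "finite A" using A finite_cube finite_subset by blast
  have finH: "finite ?H"
    using stabilizer_subset_cube [OF A] finite_cube finite_subset by blast
  let ?P = "Sigma ?H (\<lambda>z. {x \<in> A. x \<oplus> z \<in> A})"
  let ?Q = "Sigma A (\<lambda>x. {u \<in> A. u \<oplus> x \<notin> A})"
  have img: "(\<lambda>(z, x). (x, x \<oplus> z)) ` ?P \<subseteq> ?Q"
    by auto
  \<comment> \<open>The pair \<open>(x, u)\<close> determines \<open>z\<close> as
    \<open>x \<oplus> u\<close>.\<close>
  have inj: "inj_on (\<lambda>(z, x). (x, x \<oplus> z)) ?P"
    by (rule inj_on_inverseI [where g = "\<lambda>(x, u). (x \<oplus> u, x)"]) auto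
  have "finite ?Q" using fin by (intro finite_SigmaI) auto
  then have PQ: "card ?P \<le> card ?Q" by (rule card_inj_on_le [OF inj img])
  have "4 * card A * card ?H = (\<Sum>z\<in>?H. 4 * card A)" by simp
  \<comment> \<open>Each \<open>z\<close> in the stabilizer has at least 4/5 \<open>card A\<close>
    representations as a sum of two points of \<open>A\<close>.\<close>
  also have "\<dots> \<le> (\<Sum>z\<in>?H. 5 * card {x \<in> A. x \<oplus> z \<in> A})"
  proof (rule sum_mono)
    fix z assume "z \<in> ?H"
    then show "4 * card A \<le> 5 * card {x \<in> A. x \<oplus> z \<in> A}"
      using card_overlap_plus_defect [OF fin, of z] by (auto simp: stabilizer_def)
  qed
  also have "\<dots> = 5 * card ?P"
    using fin finH by (simp add: sum_distrib_left card_SigmaI)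
  also have "\<dots> \<le> 5 * card ?Q" using PQ by simp
  also have "card ?Q = (\<Sum>x\<in>A. defect A x)"
    using fin by (simp add: card_SigmaI defect_def)
  finally show ?thesis .
qed

section \<open>Subgroups of the cube\<close>

text \<open>The conjunction negates exactly the coordinates on which \<open>H\<close> vanishes
  identically. Any point supported on the other coordinates is a sum of unit vectors lying in
  \<open>H\<close>.\<close>

lemma subgroup_eq_conjunction:
  assumes H: "H \<subseteq> cube n" "(\<lambda>_. False) \<in> H" "\<And>x y. x \<in> H \<Longrightarrow> y \<in> H \<Longrightarrow> x \<oplus> y \<in> H"
    and unit: "\<And>h i. h \<in> H \<Longrightarrow> h i \<Longrightarrow> (\<lambda>j. j = i) \<in> H"
  obtains g where "anti_monotone_conjunction n g" "ones n g = H"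
proof -
  define S where "S = {i. i < n \<and> (\<forall>h\<in>H. \<not> h i)}"
  define g where "g = (\<lambda>x :: nat \<Rightarrow> bool. \<forall>i\<in>S. \<not> x i)"
  have ind: "(\<lambda>j. j \<in> T) \<in> H" if "finite T" "\<forall>i\<in>T. (\<lambda>j. j = i) \<in> H" for T
    using that
  proof (induction T rule: finite_induct)
    case empty
    then show ?case using H(2) by simp
  next
    case (insert i T)
    then have "(\<lambda>j. j = i) \<oplus> (\<lambda>j. j \<in> T) \<in> H" by (intro H(3)) auto
    moreover have "(\<lambda>j. j = i) \<oplus> (\<lambda>j. j \<in> T) = (\<lambda>j. j \<in> insert i T)"
      using insert.hyps by (auto simp: xor_pt_def fun_eq_iff)
    ultimately show ?case by simp
  qed
  have "x \<in> H" if "x \<in> cube n" "g x" for x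
  proof -
    have sub: "{j. x j} \<subseteq> {..<n}" using that(1) by (auto simp: cube_def) (meson not_le)
    then have "finite {j. x j}" by (rule finite_subset) simp
    \<comment> \<open>Since \<open>g x\<close> holds, \<open>i\<close> is outside \<open>S\<close>,
      so some element of \<open>H\<close> is nonzero at \<open>i\<close> and \<open>unit\<close>
      applies.\<close>
    moreover have "(\<lambda>j. j = i) \<in> H" if "x i" for i
      using that \<open>g x\<close> sub unit by (auto simp: g_def S_def)
    ultimately have "(\<lambda>j. j \<in> {j. x j}) \<in> H" by (intro ind) auto
    then show ?thesis by simp
  qed
  then have "ones n g = H" using H(1) by (auto simp: ones_def g_def S_def)
  moreover have "anti_monotone_conjunction n g"
    unfolding anti_monotone_conjunction_def by (rule exI [of _ S]) (auto simp: S_def g_def)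
  ultimately show ?thesis using that by blast
qed

text \<open>Translation by \<open>h\<close> flips coordinate \<open>i\<close> and so injects the
  part of \<open>H\<close> with \<open>x i\<close> false into the part with \<open>x i\<close>
  true.\<close>

lemma card_le_double_card_coordinate:
  assumes "finite H" "\<And>x y. x \<in> H \<Longrightarrow> y \<in> H \<Longrightarrow> x \<oplus> y \<in> H" "h \<in> H" "h i"
  shows "card H \<le> 2 * card {x \<in> H. x i}"
proof -
  have "card {x \<in> H. \<not> x i} \<le> card {x \<in> H. x i}"
    using assms by (intro card_inj_on_le [OF inj_on_xor [of h]]) (auto simp: xor_pt_def)
  moreover have "card ({x \<in> H. x i} \<union> {x \<in> H. \<not> x i}) = card {x \<in> H. x i} + card {x \<in> H. \<not> x i}"
    using assms(1) by (intro card_Un_disjoint) auto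
  moreover have "{x \<in> H. x i} \<union> {x \<in> H. \<not> x i} = H" by blast
  ultimately show ?thesis by simp
qed

text \<open>Pair \<open>y\<close> with its flip at coordinate \<open>i\<close>. As
  \<open>x i\<close> holds, the flip stays below \<open>x\<close>; were both in \<open>H\<close>,
  their sum, the unit vector, would be too.\<close>

lemma card_below_le_double_card_outside:
  assumes H: "\<And>x y. x \<in> H \<Longrightarrow> y \<in> H \<Longrightarrow> x \<oplus> y \<in> H" and i: "(\<lambda>j. j = i) \<notin> H"
    and x: "x \<in> cube n" "x i"
  shows "card {y \<in> cube n. y \<le> x} \<le> 2 * card {y \<in> cube n. y \<le> x \<and> y \<notin> H}"
proof -
  let ?e = "\<lambda>j. j = i"
  let ?D = "{y \<in> cube n. y \<le> x \<and> y \<in> H}" and ?E = "{y \<in> cube n. y \<le> x \<and> y \<notin> H}"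
  have "?e \<in> cube n" using x by (auto simp: cube_def)
  moreover have "y \<oplus> ?e \<notin> H" if "y \<in> H" for y
    using H [OF that, of "y \<oplus> ?e"] i by auto
  moreover have "y \<oplus> ?e \<le> x" if "y \<le> x" for y
    using that x(2) by (auto simp: le_fun_def xor_pt_def)
  ultimately have "(\<lambda>y. y \<oplus> ?e) ` ?D \<subseteq> ?E" by (auto intro: xor_in_cube)
  then have "card ?D \<le> card ?E"
    using finite_cube by (intro card_inj_on_le [OF inj_on_xor]) auto
  moreover have "card (?D \<union> ?E) = card ?D + card ?E"
    using finite_cube by (intro card_Un_disjoint) auto
  moreover have "?D \<union> ?E = {y \<in> cube n. y \<le> x}" by blast
  ultimately show ?thesis by simp
qed

section \<open>Rejection probabilities\<close>

lemma pmf_repeat_test_Accept: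
  "pmf (repeat_test k t s) Accept = pmf t True ^ k * pmf s Accept"
proof (induction k)
  case (Suc k)
  have "pmf (repeat_test (Suc k) t s) Accept =
      (\<Sum>b\<in>UNIV. pmf t b * pmf (if b then repeat_test k t s else return_pmf Reject) Accept)"
    by (simp only: repeat_test.simps pmf_bind, subst integral_measure_pmf [of UNIV]) auto
  then show ?case by (simp add: UNIV_bool Suc.IH)
qed simp

lemma prob_Reject: "measure_pmf.prob p {Reject} = 1 - pmf p Accept"
proof -
  have "(\<Sum>v\<in>{Accept, Reject}. pmf p v) = 1"
    by (rule sum_pmf_eq_1) (auto intro: verdict.exhaust)
  then show ?thesis by (simp add: measure_pmf_single)
qed

lemma pmf_bool_True: "pmf p True = 1 - pmf p False"
proof -
  have "(\<Sum>b\<in>UNIV. pmf p b) = 1" by (rule sum_pmf_eq_1) auto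
  then show ?thesis by (simp add: UNIV_bool)
qed

section \<open>Rejection probabilities of a single round\<close>

lemma prob_xor_not_ones:
  assumes f: "ones n f \<noteq> {}" and x: "x \<in> cube n"
  shows "pmf (do { u \<leftarrow> Samp n f; return_pmf (f (x \<oplus> u)) }) False
    = real (defect (ones n f) x) / real (card (ones n f))"
proof -
  let ?A = "ones n f"
  have fin: "finite ?A" using finite_cube by (simp add: ones_def)
  \<comment> \<open>Since \<open>x \<oplus> u\<close> stays in the cube, the query can be read as
    membership in \<open>ones n f\<close>. By commutativity the failing \<open>u\<close> are those
    counted by the defect of \<open>x\<close>.\<close>
  have iff: "f (x \<oplus> u) \<longleftrightarrow> u \<oplus> x \<in> ?A" if "u \<in> ?A" for u
    using that x xor_in_cube by (auto simp: ones_def xor_commute)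
  have "pmf (do { u \<leftarrow> Samp n f; return_pmf (f (x \<oplus> u)) }) False
      = (\<Sum>u\<in>?A. pmf (return_pmf (f (x \<oplus> u))) False) / real (card ?A)"
    unfolding pmf_bind Samp_def by (rule integral_pmf_of_set [OF f fin])
  also have "(\<Sum>u\<in>?A. pmf (return_pmf (f (x \<oplus> u))) False) = (\<Sum>u\<in>?A. of_bool (u \<oplus> x \<notin> ?A))"
    by (intro sum.cong refl) (simp add: iff)
  also have "\<dots> = real (defect ?A x)"
    using fin by (simp add: defect_def Int_def)
  finally show ?thesis .
qed

lemma pmf_phase1_False:
  assumes f: "ones n f \<noteq> {}"
  shows "pmf (phase1_test n f) False
    = real (\<Sum>x\<in>ones n f. defect (ones n f) x) / (real (card (ones n f)))\<^sup>2"
proof -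
  have fin: "finite (ones n f)" using finite_cube by (simp add: ones_def)
  have "pmf (phase1_test n f) False =
      (\<Sum>x\<in>ones n f. pmf (do { u \<leftarrow> Samp n f; return_pmf (f (x \<oplus> u)) }) False)
        / real (card (ones n f))"
    unfolding phase1_test_def
    by (subst pmf_bind, subst (1) Samp_def, subst integral_pmf_of_set) (use f fin in auto)
  also have "\<dots> = (\<Sum>x\<in>ones n f. real (defect (ones n f) x) / real (card (ones n f)))
        / real (card (ones n f))"
    using f by (intro arg_cong2 [where f = "(/)"] sum.cong refl prob_xor_not_ones)
      (auto simp: ones_def)
  finally show ?thesis by (simp add: sum_divide_distrib [symmetric] power2_eq_square)
qed

lemma pmf_phase2_False:
  assumes f: "ones n f \<noteq> {}"
  shows "pmf (phase2_test n f) False = (\<Sum>x\<in>ones n f.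
    (\<Sum>y | y \<in> cube n \<and> y \<le> x. real (defect (ones n f) y) / real (card (ones n f)))
      / real (card {y \<in> cube n. y \<le> x})) / real (card (ones n f))"
proof -
  have fin: "finite (ones n f)" using finite_cube by (simp add: ones_def)
  let ?u = "\<lambda>y. do { u \<leftarrow> Samp n f; return_pmf (f (y \<oplus> u)) }"
  let ?y = "\<lambda>x. pmf_of_set {y \<in> cube n. y \<le> x} \<bind> ?u"
  have inner: "pmf (?y x) False = (\<Sum>y | y \<in> cube n \<and> y \<le> x.
      real (defect (ones n f) y) / real (card (ones n f))) / real (card {y \<in> cube n. y \<le> x})"
    if "x \<in> ones n f" for x
  proof -
    have "{y \<in> cube n. y \<le> x} \<noteq> {}" using that by (auto simp: ones_def)
    then have "pmf (?y x) False =
      (\<Sum>y | y \<in> cube n \<and> y \<le> x. pmf (?u y) False)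
        / real (card {y \<in> cube n. y \<le> x})"
      by (subst pmf_bind, subst integral_pmf_of_set) (use finite_cube in auto)
    also have "(\<Sum>y | y \<in> cube n \<and> y \<le> x. pmf (?u y) False)
        = (\<Sum>y | y \<in> cube n \<and> y \<le> x. real (defect (ones n f) y) / real (card (ones n f)))"
      using f by (intro sum.cong refl prob_xor_not_ones) auto
    finally show ?thesis .
  qed
  have "pmf (phase2_test n f) False = (\<Sum>x\<in>ones n f. pmf (?y x) False) / real (card (ones n f))"
    unfolding phase2_test_def
    by (subst pmf_bind, subst (1) Samp_def, subst integral_pmf_of_set) (use f fin in auto)
  then show ?thesis using inner by (simp cong: sum.cong)
qed

text \<open>The bound is 2/5 * 1/2 * 1/5: the chance that \<open>x i\<close> holds, then that
  \<open>y\<close> misses the stabilizer, then that \<open>u\<close> exposes such a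
  \<open>y\<close>.\<close>

lemma phase2_rejects:
  assumes f: "ones n f \<noteq> {}"
    and sm: "100 * (\<Sum>x\<in>ones n f. defect (ones n f) x) \<le> card (ones n f) * card (ones n f)"
    and H: "h \<in> stabilizer (ones n f)" "h i" "(\<lambda>j. j = i) \<notin> stabilizer (ones n f)"
  shows "pmf (phase2_test n f) False \<ge> 1 / 25"
proof -
  define A where "A = ones n f"
  define H where "H = stabilizer A"
  define N where "N = real (card A)"
  define D where "D = (\<lambda>x. {y \<in> cube n. y \<le> x})"
  note assms = assms [folded A_def, folded H_def]
  have A: "A \<subseteq> cube n" "A \<noteq> {}" using f by (auto simp: ones_def A_def)
  have fin: "finite A" using A finite_cube finite_subset by blast
  have finD: "finite (D x)" for x using finite_cube by (simp add: D_def)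
  have N: "N > 0" using A fin by (simp add: N_def card_gt_0_iff)
  have Hc: "H \<subseteq> cube n" using stabilizer_subset_cube [OF A] by (simp add: H_def)
  have finH: "finite H" using Hc finite_cube finite_subset by blast
  have closed: "x \<oplus> y \<in> H" if "x \<in> H" "y \<in> H" for x y
    using stabilizer_xor [OF fin A(2) assms(2)] that by (simp add: H_def)

  \<comment> \<open>The two bounds derived next say that \<open>A - H\<close> and
    \<open>H - A\<close> have at most 1/20 and 1/80 of the size of \<open>A\<close>.\<close>
  have "100 * (card A * card (A - H)) \<le> 5 * (card A * card A)"
    using card_minus_stabilizer [OF fin] assms(2) unfolding H_def by linarith
  then have "card A * (100 * card (A - H)) \<le> card A * (5 * card A)" by simp
  then have AH: "100 * card (A - H) \<le> 5 * card A"
    using A fin by (simp only: mult_le_cancel1) (auto simp: card_gt_0_iff)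
  have "100 * (4 * card A * card (H - A)) \<le> 5 * (card A * card A)"
    using card_stabilizer_minus [OF A] assms(2) unfolding H_def by linarith
  then have "card A * (400 * card (H - A)) \<le> card A * (5 * card A)" by simp
  then have HA: "400 * card (H - A) \<le> 5 * card A"
    using A fin by (simp only: mult_le_cancel1) (auto simp: card_gt_0_iff)
  \<comment> \<open>At least 19/20 \<open>card A\<close> points lie in \<open>H\<close>, half of
    \<open>H\<close> has \<open>x i\<close>, and at most 1/80 \<open>card A\<close> of these fall
    outside \<open>A\<close>. This leaves 37/80 of \<open>A\<close>, rounded down to 2/5.\<close>
  have "card A \<le> card (A - H) + card H"
    using fin finH by (metis card_mono finite_Un Un_Diff_cancel2 Un_upper1 card_Un_le le_trans finite_Diff)
  moreover have "card H \<le> 2 * card {x \<in> H. x i}"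
    by (rule card_le_double_card_coordinate [OF finH closed assms(3,4)])
  moreover have "card {x \<in> H. x i} \<le> card ({x \<in> A. x i} \<union> (H - A))"
    using fin finH by (intro card_mono) auto
  moreover have "card ({x \<in> A. x i} \<union> (H - A)) \<le> card {x \<in> A. x i} + card (H - A)"
    by (rule card_Un_le)
  ultimately have "4 * card A \<le> 10 * card {x \<in> A. x i}" using AH HA by linarith
  then have heavy: "4 / 10 * N \<le> real (card {x \<in> A. x i})" by (simp add: N_def)

  have inner: "1 / 10 \<le> (\<Sum>y\<in>D x. real (defect A y) / N) / real (card (D x))"
    if x: "x \<in> A" "x i" for x
  proof -
    let ?E = "{y \<in> D x. y \<notin> H}"
    have "x \<in> D x" using x A by (auto simp: D_def)
    then have Dpos: "real (card (D x)) > 0" using finD by (auto simp: card_gt_0_iff)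
    have "x \<in> cube n" using x A by blast
    from card_below_le_double_card_outside [OF closed assms(5) this x(2)]
    have "card (D x) \<le> 2 * card ?E" by (simp add: D_def conj_assoc)
    then have "1 / 10 * real (card (D x)) \<le> (\<Sum>y\<in>?E. 1 / 5)" by simp
    also have "\<dots> \<le> (\<Sum>y\<in>?E. real (defect A y) / N)"
    proof (rule sum_mono)
      fix y assume "y \<in> ?E"
      then have "card A < 5 * defect A y" by (auto simp: H_def stabilizer_def)
      then have "N \<le> 5 * real (defect A y)" by (simp add: N_def)
      then show "1 / 5 \<le> real (defect A y) / N" using N by (simp add: field_simps)
    qed
    also have "\<dots> \<le> (\<Sum>y\<in>D x. real (defect A y) / N)"
      using finD N by (intro sum_mono2) auto
    finally show ?thesis using Dpos by (simp add: field_simps)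
  qed
  have "4 / 100 * N \<le> (\<Sum>x | x \<in> A \<and> x i. 1 / 10)" using heavy by simp
  also have "\<dots> \<le> (\<Sum>x | x \<in> A \<and> x i. (\<Sum>y\<in>D x. real (defect A y) / N) / real (card (D x)))"
    using inner by (intro sum_mono) auto
  also have "\<dots> \<le> (\<Sum>x\<in>A. (\<Sum>y\<in>D x. real (defect A y) / N) / real (card (D x)))"
    using fin N by (intro sum_mono2) (auto intro!: divide_nonneg_nonneg sum_nonneg)
  also have "\<dots> = pmf (phase2_test n f) False * N"
    using pmf_phase2_False [OF f] N by (simp add: A_def N_def D_def)
  finally show ?thesis using N by simp
qed

text \<open>The conjunction of all negated variables accepts only the zero point, so its relative
  distance is at most 1 + 1 / \<open>card (ones n f)\<close>. The bound on \<open>\<epsilon>\<close>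
  turns a phase 1 estimate in \<open>\<epsilon>\<close> into the absolute one that closure of the
  stabilizer requires.\<close>

lemma far_imp_epsilon_less_2:
  assumes f: "ones n f \<noteq> {}"
    and far: "\<And>g. anti_monotone_conjunction n g \<Longrightarrow> rel_dist n f g > \<epsilon>"
  shows "\<epsilon> < 2"
proof -
  have fin: "finite (ones n f)" using finite_cube by (simp add: ones_def)
  then have pos: "card (ones n f) > 0" using f by (simp add: card_gt_0_iff)
  obtain g where g: "anti_monotone_conjunction n g" "ones n g = {\<lambda>_. False}"
    by (rule subgroup_eq_conjunction [of "{\<lambda>_. False}" n]) (auto simp: cube_def)
  have "card (sym_diff (ones n f) (ones n g)) \<le> card (ones n f \<union> {\<lambda>_. False})"
    using fin g by (intro card_mono) auto
  also have "\<dots> \<le> card (ones n f) + 1"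
    using card_Un_le [of "ones n f" "{\<lambda>_. False}"] by simp
  also have "\<dots> \<le> 2 * card (ones n f)" using pos by simp
  finally have "rel_dist n f g \<le> 2" using pos by (simp add: rel_dist_def divide_le_eq)
  then show ?thesis using far [OF g(1)] by simp
qed

lemma phase1_or_phase2_rejects:
  assumes \<epsilon>: "\<epsilon> > 0" and f: "ones n f \<noteq> {}"
    and far: "\<And>g. anti_monotone_conjunction n g \<Longrightarrow> rel_dist n f g > \<epsilon>"
  shows "pmf (phase1_test n f) False \<ge> \<epsilon> / 200 \<or> pmf (phase2_test n f) False \<ge> 1 / 25"
proof (rule disjCI)
  assume "\<not> pmf (phase2_test n f) False \<ge> 1 / 25"
  then have phase2: "pmf (phase2_test n f) False < 1 / 25" by simp
  define A where "A = ones n f"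
  define H where "H = stabilizer A"
  define s where "s = (\<Sum>x\<in>A. defect A x)"
  have A: "A \<subseteq> cube n" "A \<noteq> {}" using f by (auto simp: ones_def A_def)
  have fin: "finite A" using A finite_cube finite_subset by blast
  have pos: "card A > 0" using A fin by (simp add: card_gt_0_iff)
  show "pmf (phase1_test n f) False \<ge> \<epsilon> / 200"
  proof (rule ccontr)
    assume "\<not> ?thesis"
    then have s: "200 * real s < \<epsilon> * (real (card A) * real (card A))"
      using pos by (simp add: pmf_phase1_False [OF f] A_def [symmetric] s_def field_simps
          power2_eq_square)
    \<comment> \<open>This is what fixes the 200: with \<open>\<epsilon>\<close> below 2, it yields
      the hypothesis \<open>sm\<close> of \<open>stabilizer_xor\<close>.\<close>
    have "\<epsilon> * (real (card A) * real (card A)) \<le> 2 * (real (card A) * real (card A))"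
      using far_imp_epsilon_less_2 [OF f far] by (intro mult_right_mono) auto
    with s have "real (100 * s) \<le> real (card A * card A)" by simp
    then have sm: "100 * s \<le> card A * card A" by (simp only: of_nat_le_iff)
    \<comment> \<open>A missing unit vector would make phase 2 reject with probability at least
      1/25.\<close>
    have unit: "(\<lambda>j. j = i) \<in> H" if "h \<in> H" "h i" for h i
      using phase2_rejects [OF f, of h i] sm that phase2
      by (auto simp: H_def A_def s_def)
    have closed: "x \<oplus> y \<in> H" if "x \<in> H" "y \<in> H" for x y
      using stabilizer_xor [OF fin A(2) sm [unfolded s_def]] that by (simp add: H_def)
    have Hc: "H \<subseteq> cube n" using stabilizer_subset_cube [OF A] by (simp add: H_def)
    have zero: "(\<lambda>_. False) \<in> H" by (simp add: H_def)
    obtain g where g: "anti_monotone_conjunction n g" "ones n g = H"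
      by (rule subgroup_eq_conjunction [OF Hc zero]) (use closed unit in auto)
    \<comment> \<open>The contradiction: the symmetric difference costs at most
      \<open>10 * s\<close>, which \<open>s\<close> being small places below
      \<open>\<epsilon>\<close> / 20 relative to \<open>A\<close>, against
      \<open>far\<close>.\<close>
    have "card (sym_diff A H) \<le> card (A - H) + card (H - A)" by (rule card_Un_le)
    then have "card A * card (sym_diff A H) \<le> card A * card (A - H) + card A * card (H - A)"
      by (metis add_mult_distrib2 mult_le_mono2)
    also have "\<dots> \<le> 5 * s + 5 * s"
      using card_minus_stabilizer [OF fin] card_stabilizer_minus [OF A]
      by (simp add: H_def s_def)
    finally have "real (card A * card (sym_diff A H)) \<le> real (10 * s)"
      by (simp only: of_nat_le_iff)
    then have "real (card A) * real (card (sym_diff A H)) \<le> 10 * real s" by simp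
    moreover have "\<epsilon> * real (card A) < real (card (sym_diff A H))"
      using far [OF g(1)] g(2) pos by (simp add: rel_dist_def A_def [symmetric] field_simps)
    then have "\<epsilon> * real (card A) * real (card A) < real (card (sym_diff A H)) * real (card A)"
      using pos by (intro mult_strict_right_mono) auto
    ultimately have "\<epsilon> * (real (card A) * real (card A)) < 10 * real s"
      by (simp add: mult_ac)
    with s show False by simp
  qed
qed

section \<open>Amplification by repetition\<close>

lemma one_minus_power_le_exp:
  fixes p :: real
  assumes "p \<le> 1"
  shows "(1 - p) ^ k \<le> exp (- (real k * p))"
proof -
  have "(1 - p) ^ k \<le> exp (- p) ^ k"
    using assms exp_ge_add_one_self [of "- p"] by (intro power_mono) auto
  then show ?thesis by (simp add: exp_of_nat_mult [symmetric])
qed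

lemma exp_minus_le_tenth:
  fixes t :: real
  assumes "9 \<le> t"
  shows "exp (- t) \<le> 1 / 10"
proof -
  have "10 \<le> exp t" using exp_ge_add_one_self [of t] assms by linarith
  then show ?thesis by (simp add: exp_minus field_simps)
qed

theorem theorem3p17:
  shows "\<exists>(C\<^sub>1::real) (C\<^sub>2::nat). \<forall>c\<^sub>1\<ge>C\<^sub>1. \<forall>c\<^sub>2\<ge>C\<^sub>2.
    \<forall>(n::nat) (f :: (nat \<Rightarrow> bool) \<Rightarrow> bool) (\<epsilon>::real).
      \<epsilon> > 0 \<and> ones n f \<noteq> {} \<and>
      (\<forall>f'. anti_monotone_conjunction n f' \<longrightarrow> rel_dist n f f' > \<epsilon>) \<longrightarrow>
      measure_pmf.prob (tester c\<^sub>1 c\<^sub>2 \<epsilon> n f) {Reject} \<ge> 0.9"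
proof (rule exI [of _ 1800], rule exI [of _ 225], intro allI impI, elim conjE)
  fix c\<^sub>1 \<epsilon> :: real and c\<^sub>2 n :: nat and f :: "(nat \<Rightarrow> bool) \<Rightarrow> bool"
  assume c: "1800 \<le> c\<^sub>1" "225 \<le> c\<^sub>2" and \<epsilon>: "0 < \<epsilon>" and f: "ones n f \<noteq> {}"
    and far: "\<forall>f'. anti_monotone_conjunction n f' \<longrightarrow> \<epsilon> < rel_dist n f f'"
  define k where "k = nat \<lceil>c\<^sub>1 / \<epsilon>\<rceil>"
  define p q where "p = pmf (phase1_test n f) False" and "q = pmf (phase2_test n f) False"
  have pq: "0 \<le> p" "p \<le> 1" "0 \<le> q" "q \<le> 1" by (auto simp: p_def q_def pmf_le_1)
  have accept: "pmf (tester c\<^sub>1 c\<^sub>2 \<epsilon> n f) Accept = (1 - p) ^ k * (1 - q) ^ c\<^sub>2"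
    by (simp add: tester_def pmf_repeat_test_Accept pmf_bool_True p_def q_def k_def)
  have le1: "(1 - p) ^ k \<le> 1" "(1 - q) ^ c\<^sub>2 \<le> 1" using pq by (auto intro: power_le_one)
  \<comment> \<open>One phase alone suffices, as the other factor of the acceptance probability is
    at most 1.\<close>
  have "p \<ge> \<epsilon> / 200 \<or> q \<ge> 1 / 25"
    unfolding p_def q_def using phase1_or_phase2_rejects [OF \<epsilon> f] far by blast
  then have "(1 - p) ^ k * (1 - q) ^ c\<^sub>2 \<le> 1 / 10"
  proof
    assume p: "\<epsilon> / 200 \<le> p"
    have k: "c\<^sub>1 / \<epsilon> \<le> real k" unfolding k_def by linarith
    \<comment> \<open>Here 1800 = 9 * 200, and below 225 = 9 * 25: nine expected failures suffice
      because exp 9 is at least 1 + 9. Rounding up only adds rounds.\<close>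
    have "9 \<le> c\<^sub>1 / \<epsilon> * (\<epsilon> / 200)" using c \<epsilon> by simp
    also have "\<dots> \<le> real k * p" using k p c \<epsilon> by (intro mult_mono) auto
    finally have "(1 - p) ^ k \<le> 1 / 10"
      using one_minus_power_le_exp [OF pq(2), of k] exp_minus_le_tenth by fastforce
    then show ?thesis
      using mult_mono [of "(1 - p) ^ k" "1 / 10" "(1 - q) ^ c\<^sub>2" 1] le1 pq by simp
  next
    assume "1 / 25 \<le> q"
    then have "225 * (1 / 25) \<le> real c\<^sub>2 * q" using c by (intro mult_mono) auto
    then have "(1 - q) ^ c\<^sub>2 \<le> 1 / 10"
      using one_minus_power_le_exp [OF pq(4), of c\<^sub>2] exp_minus_le_tenth [of "real c\<^sub>2 * q"] by simp
    then show ?thesis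
      using mult_mono [of "(1 - p) ^ k" 1 "(1 - q) ^ c\<^sub>2" "1 / 10"] le1 pq by simp
  qed
  then show "0.9 \<le> measure_pmf.prob (tester c\<^sub>1 c\<^sub>2 \<epsilon> n f) {Reject}"
    by (simp add: prob_Reject accept)
qed

end
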